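(* Let $\Lambda=\delta_0$ be the functional $f\mapsto f(0)$ on $C([0,1],\mathbb{C})$. Let $\mathcal{E}=\ker\Lambda=\{f\in C([0,1],\mathbb{C}) : f(0)=0\}$, let $\mathcal{F}=\{u\in \mathcal{E}\cap\mathcal{D} : u'\in \mathcal{E}\}$, where $\mathcal{D}$ is the space of continuously differentiable functions $[0,1]\to\mathbb{C}$, let $T:\mathcal{F}\to \mathcal{E}$, $Tu=u'$, and let $J:\mathcal{F}\to \mathcal{E}$ be the canonical injection. Then: (a) $\mathcal{E}$ is closed in $C([0,1],\mathbb{C})$ and $\mathcal{F}=\{u\in\mathcal{D} : u(0)=0 \text{ and } u'(0)=0\}$. (b) For every $\zeta\in\mathbb{C}$, $\zeta J-T$ is a bijection from $\mathcal{F}$ onto $\mathcal{E}$ whose inverse is the continuous mapping $R_T(\zeta)=-K_\zeta$ (restricted to $\mathcal{E}$). (c) $\rho(T)=\mathbb{C}$ and $\sigma(T)=\emptyset$. (d) For every real $\zeta>0$, $$\frac{e^\zeta-1-\zeta}{\zeta^2}\le\|R_T(\zeta)\|\le\frac{e^\zeta-1}{\zeta}.$$ (e) Consequently $\|R_T(\zeta)\|\to+\infty$ as $\zeta\to+\infty$ along the positive reals.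
   Context: $C([0,1],\mathbb{C})$ carries the sup norm $\|f\|_\infty=\max_{x\in[0,1]}|f(x)|$. Functions in $\mathcal{D}$ are right-differentiable at $0$ and left-differentiable at $1$, with continuous derivative on $[0,1]$. For $\zeta\in\mathbb{C}$ and $f\in C([0,1],\mathbb{C})$, $K_\zeta f(x)=e^{\zeta x}\int_0^x e^{-\zeta t}f(t)\,dt$ for $x\in[0,1]$. A linear map $T:\mathcal{F}\to \mathcal{E}$ from a linear subspace $\mathcal{F}$ of a complex Banach space $\mathcal{E}$ is a closed operator if whenever $u_n\in \mathcal{F}$, $u_n\to u$ in $\mathcal{E}$ and $Tu_n\to v$ in $\mathcal{E}$, then $u\in \mathcal{F}$ and $v=Tu$; then $\mathcal{F}$ with the norm $N_1^T(u)=\|u\|+\|Tu\|$ is a Banach space. For a closed $T$ (as is the case here), $\zeta\in\mathbb{C}$ is in the resolvent set $\rho(T)$ if $\zeta J-T:\mathcal{F}\to \mathcal{E}$ has an inverse that is a bounded linear map from $\mathcal{E}$ to $(\mathcal{F},N_1^T)$; this inverse is denoted $R_T(\zeta)$, and $\sigma(T)=\mathbb{C}\setminus\rho(T)$. The norm $\|R_T(\zeta)\|$ in this statement is the operator norm with both $\mathcal{E}$ and $\mathcal{F}$ carrying the sup norm $\|\cdot\|_\infty$. *)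

theory Defs
  imports "HOL-Analysis.Analysis"
begin

section \<open>Complex normed spaces and operators on linear subspaces\<close>

class complex_normed_vector = real_normed_vector +
  fixes scaleC :: "complex \<Rightarrow> 'a \<Rightarrow> 'a"  (infixr \<open>*\<^sub>C\<close> 75)
  assumes scaleC_add_right: "a *\<^sub>C (x + y) = a *\<^sub>C x + a *\<^sub>C y"
    and scaleC_add_left: "(a + b) *\<^sub>C x = a *\<^sub>C x + b *\<^sub>C x"
    and scaleC_scaleC: "a *\<^sub>C (b *\<^sub>C x) = (a * b) *\<^sub>C x"
    and scaleR_scaleC: "r *\<^sub>R x = complex_of_real r *\<^sub>C x"
    and norm_scaleC: "norm (a *\<^sub>C x) = norm a * norm x"

definition csubspace :: "'a::complex_normed_vector set \<Rightarrow> bool" where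
  "csubspace S \<longleftrightarrow> 0 \<in> S \<and> (\<forall>x\<in>S. \<forall>y\<in>S. x + y \<in> S) \<and> (\<forall>c. \<forall>x\<in>S. c *\<^sub>C x \<in> S)"

definition clinear_on ::
  "'a::complex_normed_vector set \<Rightarrow> ('a \<Rightarrow> 'b::complex_normed_vector) \<Rightarrow> bool" where
  "clinear_on S L \<longleftrightarrow>
     (\<forall>x\<in>S. \<forall>y\<in>S. L (x + y) = L x + L y) \<and> (\<forall>c. \<forall>x\<in>S. L (c *\<^sub>C x) = c *\<^sub>C L x)"

text \<open>Throughout, an operator \<open>T : F \<rightarrow> E\<close> between linear subspaces of an ambient space is a function
  on the whole type, of which only the values on \<open>F\<close> matter.\<close>

definition closed_operator ::
  "'a::complex_normed_vector set \<Rightarrow> 'a set \<Rightarrow> ('a \<Rightarrow> 'a) \<Rightarrow> bool" where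
  "closed_operator E F T \<longleftrightarrow>
     csubspace E \<and> complete E \<and> csubspace F \<and> F \<subseteq> E \<and> T ` F \<subseteq> E \<and> clinear_on F T \<and>
     (\<forall>s. \<forall>u\<in>E. \<forall>v\<in>E. (\<forall>n::nat. s n \<in> F) \<longrightarrow> s \<longlonglongrightarrow> u \<longrightarrow> (\<lambda>n. T (s n)) \<longlonglongrightarrow> v
        \<longrightarrow> u \<in> F \<and> v = T u)"

definition graph_norm :: "('a \<Rightarrow> 'a) \<Rightarrow> 'a::real_normed_vector \<Rightarrow> real" where
  "graph_norm T u = norm u + norm (T u)"

definition bounded_clinear_on ::
  "'a::complex_normed_vector set \<Rightarrow> ('b \<Rightarrow> real) \<Rightarrow> ('a \<Rightarrow> 'b::complex_normed_vector) \<Rightarrow> bool" where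
  "bounded_clinear_on E N R \<longleftrightarrow> clinear_on E R \<and> (\<exists>B. \<forall>f\<in>E. N (R f) \<le> B * norm f)"

definition resolvent ::
  "'a::complex_normed_vector set \<Rightarrow> ('a \<Rightarrow> 'a) \<Rightarrow> complex \<Rightarrow> 'a \<Rightarrow> 'a" where
  "resolvent F T \<zeta> = inv_into F (\<lambda>u. \<zeta> *\<^sub>C u - T u)"

definition resolvent_set ::
  "'a::complex_normed_vector set \<Rightarrow> 'a set \<Rightarrow> ('a \<Rightarrow> 'a) \<Rightarrow> complex set" where
  "resolvent_set E F T =
     {\<zeta>. bij_betw (\<lambda>u. \<zeta> *\<^sub>C u - T u) F E \<and>
          bounded_clinear_on E (graph_norm T) (resolvent F T \<zeta>)}"

definition spectrum ::
  "'a::complex_normed_vector set \<Rightarrow> 'a set \<Rightarrow> ('a \<Rightarrow> 'a) \<Rightarrow> complex set" where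
  "spectrum E F T = - resolvent_set E F T"

text \<open>The analogue of \<^const>\<open>onorm\<close> for an operator defined on a subspace. As there, the
  quotient at \<open>f = 0\<close> is \<open>0\<close>.\<close>

definition onorm_on ::
  "'a::real_normed_vector set \<Rightarrow> ('a \<Rightarrow> 'b::real_normed_vector) \<Rightarrow> real" where
  "onorm_on E R = (SUP f\<in>E. norm (R f) / norm f)"


section \<open>The Banach space of continuous complex functions on the unit interval\<close>

typedef unit_interval = "{0..1::real}"
  morphisms real_of_ui ui
  by (rule exI[of _ 0]) simp

instantiation unit_interval :: metric_space
begin

definition "dist x y = dist (real_of_ui x) (real_of_ui y)"

definition "uniformity = (INF e\<in>{0 <..}. principal {(x::unit_interval, y). dist x y < e})"

definition "open (U :: unit_interval set) \<longleftrightarrow>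
  (\<forall>x\<in>U. eventually (\<lambda>(x', y). x' = x \<longrightarrow> y \<in> U) uniformity)"

instance
  by standard (auto simp: dist_unit_interval_def uniformity_unit_interval_def
      open_unit_interval_def real_of_ui_inject dist_triangle2)

end

type_synonym C01 = "unit_interval \<Rightarrow>\<^sub>C complex"

definition fun01 :: "C01 \<Rightarrow> real \<Rightarrow> complex" where
  "fun01 f t = apply_bcontfun f (ui t)"

definition mk01 :: "(real \<Rightarrow> complex) \<Rightarrow> C01" where
  "mk01 g = Bcontfun (\<lambda>x. g (real_of_ui x))"

lemma real_of_ui_bounds [simp]: "0 \<le> real_of_ui x" "real_of_ui x \<le> 1"
  using real_of_ui[of x] by auto

lemma continuous_on_real_of_ui: "continuous_on S real_of_ui"
  unfolding continuous_on_iff dist_unit_interval_def by blast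

lemma continuous_on_ui: "continuous_on {0..1} ui"
  unfolding continuous_on_iff dist_unit_interval_def by (metis ui_inverse)

lemma continuous_on_fun01: "continuous_on {0..1} (fun01 f)"
proof -
  have "continuous_on {0..1} (apply_bcontfun f \<circ> ui)"
    by (intro continuous_on_compose continuous_on_ui continuous_on_apply_bcontfun)
  then show ?thesis by (simp add: fun01_def[abs_def] comp_def)
qed

lemma mk01_in_bcontfun:
  assumes "continuous_on {0..1} g"
  shows "(\<lambda>x. g (real_of_ui x)) \<in> bcontfun"
proof -
  have "continuous_on UNIV (g \<circ> real_of_ui)"
    by (rule continuous_on_compose[OF continuous_on_real_of_ui])
       (rule continuous_on_subset[OF assms], auto)
  moreover have "bounded (g ` {0..1})"
    using assms by (intro compact_imp_bounded compact_continuous_image) auto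
  then have "bounded (range (\<lambda>x. g (real_of_ui x)))"
    by (rule bounded_subset) auto
  ultimately show ?thesis by (simp add: bcontfun_def comp_def)
qed

lemma fun01_mk01:
  assumes "continuous_on {0..1} g" "t \<in> {0..1}"
  shows "fun01 (mk01 g) t = g t"
  using mk01_in_bcontfun[OF assms(1)] assms(2)
  by (simp add: fun01_def mk01_def Bcontfun_inverse ui_inverse)

lemma fun01_eqI:
  assumes "\<And>t. t \<in> {0..1} \<Longrightarrow> fun01 f t = fun01 g t"
  shows "f = g"
proof (rule bcontfun_eqI)
  fix x
  show "apply_bcontfun f x = apply_bcontfun g x"
    using assms[of "real_of_ui x"] by (simp add: fun01_def real_of_ui_inverse)
qed

lemma norm_C01: "norm (f :: C01) = (SUP x\<in>{0..1}. norm (fun01 f x))"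
proof -
  have "norm f = (SUP x. norm (apply_bcontfun f x))"
    by (simp add: norm_bcontfun_def dist_bcontfun_def)
  also have "range (\<lambda>x. norm (apply_bcontfun f x)) = (\<lambda>x. norm (fun01 f x)) ` {0..1}"
  proof (intro equalityI subsetI)
    fix y assume "y \<in> range (\<lambda>x. norm (apply_bcontfun f x))"
    then obtain x where "y = norm (apply_bcontfun f x)" by auto
    then have "y = norm (fun01 f (real_of_ui x))" by (simp add: fun01_def real_of_ui_inverse)
    then show "y \<in> (\<lambda>x. norm (fun01 f x)) ` {0..1}" by auto
  qed (auto simp: fun01_def)
  finally show ?thesis .
qed

instantiation complex :: complex_normed_vector
begin

definition scaleC_complex :: "complex \<Rightarrow> complex \<Rightarrow> complex" where
  "scaleC_complex a x = a * x"

instance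
  by standard (auto simp: scaleC_complex_def algebra_simps norm_mult scaleR_conv_of_real)

end

instantiation bcontfun :: (topological_space, complex_normed_vector) complex_normed_vector
begin

definition scaleC_bcontfun :: "complex \<Rightarrow> ('a \<Rightarrow>\<^sub>C 'b) \<Rightarrow> 'a \<Rightarrow>\<^sub>C 'b" where
  "scaleC_bcontfun a f = Bcontfun (\<lambda>x. a *\<^sub>C apply_bcontfun f x)"

lemma bounded_linear_scaleC: "bounded_linear (\<lambda>x::'b. a *\<^sub>C x)"
  by (rule bounded_linear_intro[where K = "norm a"])
     (simp_all add: scaleC_add_right scaleR_scaleC scaleC_scaleC norm_scaleC mult.commute)

lemma apply_scaleC_bcontfun [simp]:
  fixes f :: "'a \<Rightarrow>\<^sub>C 'b"
  shows "apply_bcontfun (a *\<^sub>C f) x = a *\<^sub>C apply_bcontfun f x"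
proof -
  have "(\<lambda>x. a *\<^sub>C apply_bcontfun f x) \<in> bcontfun"
  proof (rule bcontfun_normI)
    show "continuous_on UNIV (\<lambda>x. a *\<^sub>C apply_bcontfun f x)"
      by (intro bounded_linear.continuous_on[OF bounded_linear_scaleC]
          continuous_on_apply_bcontfun)
    show "norm (a *\<^sub>C apply_bcontfun f x) \<le> norm a * norm f" for x
      by (simp add: norm_scaleC mult_left_mono norm_bounded)
  qed
  then show ?thesis by (simp add: scaleC_bcontfun_def Bcontfun_inverse)
qed

lemma norm_scaleC_bcontfun_le:
  fixes f :: "'a \<Rightarrow>\<^sub>C 'b"
  shows "norm (a *\<^sub>C f) \<le> norm a * norm f"
  by (rule norm_bound) (simp add: norm_scaleC mult_left_mono norm_bounded)

instance
proof
  fix a b :: complex and r :: real and x y :: "'a \<Rightarrow>\<^sub>C 'b"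
  show "a *\<^sub>C (x + y) = a *\<^sub>C x + a *\<^sub>C y"
    by (rule bcontfun_eqI) (simp add: scaleC_add_right)
  show "(a + b) *\<^sub>C x = a *\<^sub>C x + b *\<^sub>C x"
    by (rule bcontfun_eqI) (simp add: scaleC_add_left)
  show assoc: "a *\<^sub>C (b *\<^sub>C x) = (a * b) *\<^sub>C x" for a b and x :: "'a \<Rightarrow>\<^sub>C 'b"
    by (rule bcontfun_eqI) (simp add: scaleC_scaleC)
  show real: "r *\<^sub>R x = complex_of_real r *\<^sub>C x" for r
    by (rule bcontfun_eqI) (simp add: scaleR_scaleC)
  show "norm (a *\<^sub>C x) = norm a * norm x"
  proof (cases "a = 0")
    case True
    then have "a *\<^sub>C x = 0" using real[of 0] by simp
    then show ?thesis using True by simp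
  next
    case False
    have "inverse a *\<^sub>C (a *\<^sub>C x) = x"
      using False real[of 1] by (simp add: assoc)
    then have "norm x \<le> norm (inverse a) * norm (a *\<^sub>C x)"
      using norm_scaleC_bcontfun_le[of "inverse a" "a *\<^sub>C x"] by simp
    then have "norm a * norm x \<le> norm (a *\<^sub>C x)"
      using False by (simp add: norm_divide field_simps)
    then show ?thesis using norm_scaleC_bcontfun_le[of a x] by simp
  qed
qed

end

lemma fun01_add [simp]: "fun01 (f + g) t = fun01 f t + fun01 g t"
  by (simp add: fun01_def)

lemma fun01_diff [simp]: "fun01 (f - g) t = fun01 f t - fun01 g t"
  by (simp add: fun01_def)

lemma fun01_minus [simp]: "fun01 (- f) t = - fun01 f t"
  by (simp add: fun01_def)

lemma fun01_zero [simp]: "fun01 0 t = 0"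
  by (simp add: fun01_def)

lemma fun01_scaleC [simp]: "fun01 (c *\<^sub>C f) t = c * fun01 f t"
  by (simp add: fun01_def scaleC_complex_def)


section \<open>The spaces and operators of the theorem\<close>

text \<open>Derivatives are taken within \<open>[0,1]\<close>, so they are one-sided at the endpoints.\<close>

definition deriv01 :: "C01 \<Rightarrow> real \<Rightarrow> complex" where
  "deriv01 u x = vector_derivative (fun01 u) (at x within {0..1})"

definition D_space :: "C01 set" where
  "D_space = {u. fun01 u differentiable_on {0..1} \<and> continuous_on {0..1} (deriv01 u)}"

definition T_op :: "C01 \<Rightarrow> C01" where
  "T_op u = mk01 (deriv01 u)"

definition Lambda :: "C01 \<Rightarrow> complex" where
  "Lambda f = fun01 f 0"

definition E_space :: "C01 set" where
  "E_space = {f. Lambda f = 0}"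

definition F_space :: "C01 set" where
  "F_space = {u \<in> E_space \<inter> D_space. T_op u \<in> E_space}"

definition K_op :: "complex \<Rightarrow> C01 \<Rightarrow> C01" where
  "K_op \<zeta> f = mk01 (\<lambda>x. exp (\<zeta> * complex_of_real x) *
     integral {0..x} (\<lambda>t. exp (- \<zeta> * complex_of_real t) * fun01 f t))"

lemma fun01_K_op:
  assumes "x \<in> {0..1}"
  shows "fun01 (K_op \<zeta> f) x = exp (\<zeta> * complex_of_real x) *
     integral {0..x} (\<lambda>t. exp (- \<zeta> * complex_of_real t) * fun01 f t)"
  unfolding K_op_def
proof (rule fun01_mk01[OF _ assms])
  have "continuous_on {0..1} (\<lambda>t. exp (- \<zeta> * complex_of_real t) * fun01 f t)"
    by (intro continuous_intros continuous_on_fun01)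
  then have "(\<lambda>t. exp (- \<zeta> * complex_of_real t) * fun01 f t) integrable_on {0..1}"
    by (rule integrable_continuous_real)
  then have "continuous_on {0..1}
      (\<lambda>x. integral {0..x} (\<lambda>t. exp (- \<zeta> * complex_of_real t) * fun01 f t))"
    by (rule indefinite_integral_continuous_1)
  then show "continuous_on {0..1} (\<lambda>x. exp (\<zeta> * complex_of_real x) *
      integral {0..x} (\<lambda>t. exp (- \<zeta> * complex_of_real t) * fun01 f t))"
    by (intro continuous_intros)
qed

lemma fun01_T_op:
  assumes "u \<in> D_space" "x \<in> {0..1}"
  shows "fun01 (T_op u) x = deriv01 u x"
  using assms by (simp add: T_op_def D_space_def fun01_mk01)

lemma has_vector_derivative_T_op:
  assumes "u \<in> D_space" "x \<in> {0..1}"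
  shows "(fun01 u has_vector_derivative fun01 (T_op u) x) (at x within {0..1})"
  using assms
  by (auto simp: fun01_T_op D_space_def deriv01_def differentiable_on_def
      vector_derivative_works[symmetric])

lemma D_spaceI:
  assumes "\<And>x. x \<in> {0..1} \<Longrightarrow> (fun01 u has_vector_derivative fun01 v x) (at x within {0..1})"
  shows "u \<in> D_space" and "T_op u = v"
proof -
  have eq: "deriv01 u x = fun01 v x" if "x \<in> {0..1}" for x
    unfolding deriv01_def using that assms[OF that]
    by (intro vector_derivative_within) (auto simp: trivial_limit_within)
  have "continuous_on {0..1} (deriv01 u)"
    by (rule continuous_on_eq[OF continuous_on_fun01[of v]]) (simp add: eq)
  moreover have "fun01 u differentiable_on {0..1}"
    unfolding differentiable_on_def using assms differentiableI_vector by blast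
  ultimately show D: "u \<in> D_space" by (simp add: D_space_def)
  show "T_op u = v"
    by (rule fun01_eqI) (simp add: fun01_T_op[OF D] eq)
qed

lemma csubspace_E_space: "csubspace E_space"
  by (simp add: csubspace_def E_space_def Lambda_def)

lemma tendsto_fun01:
  assumes "(s \<longlongrightarrow> f) G"
  shows "((\<lambda>n. fun01 (s n) t) \<longlongrightarrow> fun01 f t) G"
  unfolding fun01_def
  by (rule tendsto_uniform_limitI[OF tendsto_bcontfun_uniform_limit[OF assms]]) simp

lemma closed_E_space: "closed E_space"
  unfolding closed_sequential_limits
proof safe
  fix s f assume s: "\<forall>n. s n \<in> E_space" "s \<longlonglongrightarrow> f"
  have "(\<lambda>n. fun01 (s n) 0) \<longlonglongrightarrow> fun01 f 0" by (rule tendsto_fun01[OF s(2)])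
  moreover have "(\<lambda>n. fun01 (s n) 0) = (\<lambda>n. 0)"
    using s(1) by (simp add: E_space_def Lambda_def)
  ultimately show "f \<in> E_space"
    by (simp add: E_space_def Lambda_def LIMSEQ_const_iff)
qed

lemma T_op_add:
  assumes "u \<in> D_space" "v \<in> D_space"
  shows "u + v \<in> D_space" "T_op (u + v) = T_op u + T_op v"
proof -
  have "(fun01 (u + v) has_vector_derivative fun01 (T_op u + T_op v) x) (at x within {0..1})"
    if "x \<in> {0..1}" for x
    using has_vector_derivative_add[OF has_vector_derivative_T_op[OF assms(1) that]
        has_vector_derivative_T_op[OF assms(2) that]]
    by (simp add: fun01_def[abs_def])
  note deriv = this
  show "u + v \<in> D_space" by (rule D_spaceI(1)[OF deriv])
  show "T_op (u + v) = T_op u + T_op v" by (rule D_spaceI(2)[OF deriv])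
qed

lemma T_op_scaleC:
  assumes "u \<in> D_space"
  shows "c *\<^sub>C u \<in> D_space" "T_op (c *\<^sub>C u) = c *\<^sub>C T_op u"
proof -
  have "(fun01 (c *\<^sub>C u) has_vector_derivative fun01 (c *\<^sub>C T_op u) x) (at x within {0..1})"
    if "x \<in> {0..1}" for x
    using has_vector_derivative_mult_right[OF has_vector_derivative_T_op[OF assms that], of c]
    by (simp add: fun01_def[abs_def] scaleC_complex_def)
  note deriv = this
  show "c *\<^sub>C u \<in> D_space" by (rule D_spaceI(1)[OF deriv])
  show "T_op (c *\<^sub>C u) = c *\<^sub>C T_op u" by (rule D_spaceI(2)[OF deriv])
qed

lemma T_op_zero: "0 \<in> D_space" "T_op 0 = 0"
proof -
  have "(fun01 0 has_vector_derivative fun01 0 x) (at x within {0..1})" for x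
    by (simp add: fun01_def[abs_def])
  note deriv = this
  show "0 \<in> D_space" by (rule D_spaceI(1)[OF deriv])
  show "T_op 0 = 0" by (rule D_spaceI(2)[OF deriv])
qed

lemma T_op_closed:
  assumes D: "\<And>n. s n \<in> D_space" and s: "s \<longlonglongrightarrow> u" and Ts: "(\<lambda>n. T_op (s n)) \<longlonglongrightarrow> v"
  shows "u \<in> D_space" "T_op u = v"
proof -
  have "\<exists>g. \<forall>x\<in>{0..1}. (\<lambda>n. fun01 (s n) x) \<longlonglongrightarrow> g x \<and>
      (g has_derivative (\<lambda>h. h *\<^sub>R fun01 v x)) (at x within {0..1})"
  proof (rule has_derivative_sequence[where ?x0.0 = 0 and l = "fun01 u 0"])
    show "(fun01 (s n) has_derivative (\<lambda>h. h *\<^sub>R fun01 (T_op (s n)) x)) (at x within {0..1})"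
      if "x \<in> {0..1}" for n x
      using has_vector_derivative_T_op[OF D that] by (simp add: has_vector_derivative_def)
    show "\<forall>\<^sub>F n in sequentially. \<forall>x\<in>{0..1}. \<forall>h.
        norm (h *\<^sub>R fun01 (T_op (s n)) x - h *\<^sub>R fun01 v x) \<le> e * norm h" if "e > 0" for e
      using tendstoD[OF Ts that]
    proof eventually_elim
      case (elim n)
      show ?case
      proof (intro ballI allI)
        fix x h :: real
        have "norm (fun01 (T_op (s n)) x - fun01 v x) \<le> e"
          using elim norm_bounded[of "T_op (s n) - v" "ui x"] by (simp add: dist_norm fun01_def)
        then have "\<bar>h\<bar> * norm (fun01 (T_op (s n)) x - fun01 v x) \<le> \<bar>h\<bar> * e"
          by (rule mult_left_mono) simp
        then show "norm (h *\<^sub>R fun01 (T_op (s n)) x - h *\<^sub>R fun01 v x) \<le> e * norm h"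
          by (simp only: scaleR_diff_right[symmetric] norm_scaleR real_norm_def mult.commute)
      qed
    qed
    show "(\<lambda>n. fun01 (s n) 0) \<longlonglongrightarrow> fun01 u 0" by (rule tendsto_fun01[OF s])
  qed auto
  then obtain g where g: "\<And>x. x \<in> {0..1} \<Longrightarrow> (\<lambda>n. fun01 (s n) x) \<longlonglongrightarrow> g x"
    "\<And>x. x \<in> {0..1} \<Longrightarrow> (g has_vector_derivative fun01 v x) (at x within {0..1})"
    unfolding has_vector_derivative_def by blast
  have gu: "g x = fun01 u x" if "x \<in> {0..1}" for x
    using LIMSEQ_unique[OF g(1)[OF that] tendsto_fun01[OF s]] .
  have "(fun01 u has_vector_derivative fun01 v x) (at x within {0..1})" if "x \<in> {0..1}" for x
    by (rule has_vector_derivative_transform[OF that _ g(2)[OF that]]) (simp add: gu)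
  note deriv = this
  show "u \<in> D_space" by (rule D_spaceI(1)[OF deriv])
  show "T_op u = v" by (rule D_spaceI(2)[OF deriv])
qed

text \<open>The resolvent set is meaningful for closed operators; \<open>T\<close> is one.\<close>

lemma closed_operator_T_op: "closed_operator E_space F_space T_op"
  unfolding closed_operator_def
proof (intro conjI allI ballI impI)
  show "complete E_space"
    using closed_E_space by (simp add: complete_eq_closed)
  show "csubspace F_space"
    using csubspace_E_space
    by (auto simp: csubspace_def F_space_def T_op_add T_op_scaleC T_op_zero)
  show "F_space \<subseteq> E_space" "T_op ` F_space \<subseteq> E_space"
    by (auto simp: F_space_def)
  show "clinear_on F_space T_op"
    by (auto simp: clinear_on_def F_space_def T_op_add T_op_scaleC)
  fix s u v
  assume "u \<in> E_space" "v \<in> E_space" and s: "\<forall>n. s n \<in> F_space" "s \<longlonglongrightarrow> u"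
    "(\<lambda>n. T_op (s n)) \<longlonglongrightarrow> v"
  have D: "s n \<in> D_space" for n using s(1) by (simp add: F_space_def)
  show "v = T_op u" using T_op_closed[OF D s(2,3)] by simp
  then show "u \<in> F_space"
    using T_op_closed[OF D s(2,3)] \<open>u \<in> E_space\<close> \<open>v \<in> E_space\<close> by (simp add: F_space_def)
qed (rule csubspace_E_space)

end

(* Variation of constants: K f is the unique solution of u' = z u + f with u 0 = 0, so - K inverts
   z J - T.  The upper bound integrates exp (z (x - t)) over [0, x], and the lower bound evaluates
   K f at 1 for the unit vector f t = t. *)
theory Submission
  imports Defs "HOL-Real_Asymp.Real_Asymp"
begin

section \<open>Linearity of the integral operator\<close>

lemma integrable_K_integrand:
  assumes "x \<le> 1"
  shows "(\<lambda>t. exp (- \<zeta> * complex_of_real t) * fun01 f t) integrable_on {0..x}"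
  using assms
  by (intro integrable_continuous_real continuous_intros
      continuous_on_subset[OF continuous_on_fun01]) auto

lemma K_op_add: "K_op \<zeta> (f + g) = K_op \<zeta> f + K_op \<zeta> g"
  by (rule fun01_eqI)
     (simp add: fun01_K_op distrib_left Henstock_Kurzweil_Integration.integral_add
       integrable_K_integrand[simplified])

lemma K_op_scaleC: "K_op \<zeta> (c *\<^sub>C f) = c *\<^sub>C K_op \<zeta> f"
  by (rule fun01_eqI) (simp add: fun01_K_op mult.left_commute[of _ c])

text \<open>Lets \<open>T_op_scaleC\<close> with scalar -1 handle the sign in
  \<open>- K_op \<zeta> f\<close>.\<close>

lemma minus_eq_scaleC: "- f = (- 1) *\<^sub>C (f :: C01)"
  by (rule fun01_eqI) simp

lemma K_op_diff: "K_op \<zeta> (f - g) = K_op \<zeta> f - K_op \<zeta> g"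
  by (rule fun01_eqI)
     (simp add: fun01_K_op right_diff_distrib Henstock_Kurzweil_Integration.integral_diff
       integrable_K_integrand[simplified])

section \<open>Two-sided inversion of the operator pencil\<close>

text \<open>Product rule: differentiating the exponential factor produces the \<open>\<zeta>\<close>
  term, and differentiating the integral leaves \<open>f\<close>, since the two exponentials
  cancel.\<close>

lemma
  shows K_op_in_D_space: "K_op \<zeta> f \<in> D_space"
    and T_op_K_op: "T_op (K_op \<zeta> f) = \<zeta> *\<^sub>C K_op \<zeta> f + f"
proof -
  have deriv: "(fun01 (K_op \<zeta> f) has_vector_derivative fun01 (\<zeta> *\<^sub>C K_op \<zeta> f + f) x)
      (at x within {0..1})" if x: "x \<in> {0..1}" for x
  proof -
    let ?g = "\<lambda>t. exp (- \<zeta> * complex_of_real t) * fun01 f t"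
    have "((\<lambda>x. integral {0..x} ?g) has_vector_derivative ?g x) (at x within {0..1})"
      by (intro integral_has_vector_derivative continuous_intros continuous_on_fun01 x)
    moreover have "((\<lambda>x. exp (\<zeta> * complex_of_real x)) has_vector_derivative
        \<zeta> * exp (\<zeta> * complex_of_real x)) (at x within {0..1})"
      by (rule has_vector_derivative_real_field)
         (auto intro!: derivative_eq_intros)
    ultimately have "((\<lambda>x. exp (\<zeta> * complex_of_real x) * integral {0..x} ?g)
        has_vector_derivative exp (\<zeta> * complex_of_real x) * ?g x
          + \<zeta> * exp (\<zeta> * complex_of_real x) * integral {0..x} ?g) (at x within {0..1})"
      by (intro has_vector_derivative_mult)
    moreover have "exp (\<zeta> * complex_of_real x) * ?g x
          + \<zeta> * exp (\<zeta> * complex_of_real x) * integral {0..x} ?g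
        = fun01 (\<zeta> *\<^sub>C K_op \<zeta> f + f) x"
      using x by (simp add: fun01_K_op exp_minus)
    \<comment> \<open>The explicit formula is available for \<open>fun01 (K_op \<zeta> f)\<close>
      only on the unit interval, so the derivative is transferred within that set.\<close>
    ultimately show ?thesis
      by - (rule has_vector_derivative_transform[OF x fun01_K_op], simp_all)
  qed
  show "K_op \<zeta> f \<in> D_space" by (rule D_spaceI(1)[OF deriv])
  show "T_op (K_op \<zeta> f) = \<zeta> *\<^sub>C K_op \<zeta> f + f" by (rule D_spaceI(2)[OF deriv])
qed

text \<open>Integrating factor: the integrand of \<open>K_op\<close> is the derivative of
  \<open>exp (- \<zeta> * t) * u t\<close>, whose value at 0 vanishes. This is uniqueness for the
  initial value problem, and it also evaluates \<open>K_op\<close> once a solution has been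
  guessed.\<close>

lemma K_op_eqI:
  assumes D: "u \<in> D_space" and u0: "fun01 u 0 = 0"
  shows "K_op \<zeta> (T_op u - \<zeta> *\<^sub>C u) = u"
proof (rule fun01_eqI)
  fix x :: real assume x: "x \<in> {0..1}"
  let ?g = "\<lambda>t. exp (- \<zeta> * complex_of_real t) * fun01 (T_op u - \<zeta> *\<^sub>C u) t"
  let ?h = "\<lambda>t. exp (- \<zeta> * complex_of_real t) * fun01 u t"
  have "(?h has_vector_derivative ?g t) (at t within {0..x})" if t: "t \<in> {0..x}" for t
  proof -
    have "(fun01 u has_vector_derivative fun01 (T_op u) t) (at t within {0..x})"
      by (rule has_vector_derivative_within_subset[OF has_vector_derivative_T_op[OF D]])
         (use t x in auto)
    moreover have "((\<lambda>t. exp (- \<zeta> * complex_of_real t)) has_vector_derivative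
        - \<zeta> * exp (- \<zeta> * complex_of_real t)) (at t within {0..x})"
      by (rule has_vector_derivative_real_field)
         (auto intro!: derivative_eq_intros)
    ultimately have "(?h has_vector_derivative exp (- \<zeta> * complex_of_real t) * fun01 (T_op u) t
        + - \<zeta> * exp (- \<zeta> * complex_of_real t) * fun01 u t) (at t within {0..x})"
      by (intro has_vector_derivative_mult)
    then show ?thesis by (simp add: algebra_simps)
  qed
  then have "(?g has_integral (?h x - ?h 0)) {0..x}"
    using x by (intro fundamental_theorem_of_calculus) auto
  then have "integral {0..x} ?g = ?h x"
    using u0 by (simp add: integral_unique)
  then show "fun01 (K_op \<zeta> (T_op u - \<zeta> *\<^sub>C u)) x = fun01 u x"
    using x by (simp add: fun01_K_op exp_minus)
qed

text \<open>The derivative at 0 is \<open>- (\<zeta> * K f 0 + f 0)\<close>; the integral over a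
  point vanishes, so membership in \<open>F_space\<close> comes down to
  \<open>f 0 = 0\<close>.\<close>

lemma minus_K_op_in_F_space:
  assumes "f \<in> E_space"
  shows "- K_op \<zeta> f \<in> F_space" and "\<zeta> *\<^sub>C (- K_op \<zeta> f) - T_op (- K_op \<zeta> f) = f"
proof -
  have T: "T_op (- K_op \<zeta> f) = - (\<zeta> *\<^sub>C K_op \<zeta> f + f)"
    by (simp only: minus_eq_scaleC[of "K_op \<zeta> f"] T_op_scaleC(2)[OF K_op_in_D_space] T_op_K_op
        minus_eq_scaleC[of "\<zeta> *\<^sub>C K_op \<zeta> f + f"])
  have "- K_op \<zeta> f \<in> D_space"
    by (simp only: minus_eq_scaleC[of "K_op \<zeta> f"] T_op_scaleC(1)[OF K_op_in_D_space])
  then show "- K_op \<zeta> f \<in> F_space"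
    using assms by (simp add: F_space_def T E_space_def Lambda_def fun01_K_op)
  show "\<zeta> *\<^sub>C (- K_op \<zeta> f) - T_op (- K_op \<zeta> f) = f"
    unfolding T by (rule fun01_eqI) simp
qed

lemma K_op_left_inverse:
  assumes "u \<in> F_space"
  shows "- K_op \<zeta> (\<zeta> *\<^sub>C u - T_op u) = u"
proof -
  have "K_op \<zeta> (T_op u - \<zeta> *\<^sub>C u) = u"
    using assms by (intro K_op_eqI) (auto simp: F_space_def E_space_def Lambda_def)
  then show ?thesis by (simp only: K_op_diff minus_diff_eq)
qed

lemma bij_betw_resolvent: "bij_betw (\<lambda>u. \<zeta> *\<^sub>C u - T_op u) F_space E_space"
proof (rule bij_betwI[where g = "\<lambda>f. - K_op \<zeta> f"])
  show "(\<lambda>u. \<zeta> *\<^sub>C u - T_op u) \<in> F_space \<rightarrow> E_space"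
    by (auto simp: F_space_def E_space_def Lambda_def)
qed (auto simp: minus_K_op_in_F_space K_op_left_inverse)

text \<open>By injectivity, the preimage chosen by \<open>inv_into\<close> must be the explicit
  one.\<close>

lemma resolvent_eq:
  assumes "f \<in> E_space"
  shows "resolvent F_space T_op \<zeta> f = - K_op \<zeta> f"
  unfolding resolvent_def
  by (rule inv_into_f_eq[OF bij_betw_imp_inj_on[OF bij_betw_resolvent]
        minus_K_op_in_F_space[OF assms]])

section \<open>Upper bound for the norm, continuity and graph-norm boundedness\<close>

lemma norm_fun01_le: "norm (fun01 f t) \<le> norm f"
  by (simp add: fun01_def norm_bounded)

lemma norm_C01_le:
  assumes "\<And>t. t \<in> {0..1} \<Longrightarrow> norm (fun01 f t) \<le> B"
  shows "norm f \<le> B"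
  unfolding norm_C01 by (rule cSUP_least) (use assms in auto)

text \<open>The kernel \<open>exp (\<zeta> * (x - t))\<close> has modulus at most
  \<open>exp (r * (x - t))\<close> because t does not exceed x. The free parameter \<open>r\<close>
  serves twice: \<open>r = \<zeta>\<close> gives the stated bound for positive real
  \<open>\<zeta>\<close>, and a larger \<open>r\<close> covers every complex
  \<open>\<zeta>\<close>.\<close>

lemma norm_K_op_le:
  assumes r: "0 < r" "Re \<zeta> \<le> r"
  shows "norm (K_op \<zeta> f) \<le> (exp r - 1) / r * norm f"
proof (rule norm_C01_le)
  fix x :: real assume x: "x \<in> {0..1}"
  let ?g = "\<lambda>t. exp (- \<zeta> * complex_of_real t) * fun01 f t"
  \<comment> \<open>An antiderivative in t of the majorant; the minus sign comes from the inner
    derivative of \<open>x - t\<close>.\<close>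
  let ?H = "\<lambda>t. - (exp (r * (x - t)) / r * norm f)"
  have H: "((\<lambda>t. exp (r * (x - t)) * norm f) has_integral (?H x - ?H 0)) {0..x}"
    using x r
    by (intro fundamental_theorem_of_calculus)
       (auto intro!: derivative_eq_intros
          simp flip: has_real_derivative_iff_has_vector_derivative)
  have "fun01 (K_op \<zeta> f) x = integral {0..x} (\<lambda>t. exp (\<zeta> * complex_of_real x) * ?g t)"
    using x by (simp add: fun01_K_op)
  also have "norm \<dots> \<le> integral {0..x} (\<lambda>t. exp (r * (x - t)) * norm f)"
  proof (rule integral_norm_bound_integral)
    show "(\<lambda>t. exp (\<zeta> * complex_of_real x) * ?g t) integrable_on {0..x}"
      using x by (intro integrable_on_mult_right integrable_K_integrand) auto
    show "(\<lambda>t. exp (r * (x - t)) * norm f) integrable_on {0..x}"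
      using H by blast
    fix t assume t: "t \<in> {0..x}"
    have "norm (exp (\<zeta> * complex_of_real x) * ?g t) = exp (Re \<zeta> * (x - t)) * norm (fun01 f t)"
      by (simp add: norm_mult right_diff_distrib exp_diff exp_minus divide_inverse norm_inverse)
    also have "\<dots> \<le> exp (r * (x - t)) * norm f"
      using t r by (intro mult_mono norm_fun01_le) (auto intro: mult_right_mono)
    finally show "norm (exp (\<zeta> * complex_of_real x) * ?g t) \<le> exp (r * (x - t)) * norm f" .
  qed
  also have "\<dots> = (exp (r * x) - 1) / r * norm f"
    unfolding integral_unique[OF H] by (simp add: diff_divide_distrib left_diff_distrib)
  also have "\<dots> \<le> (exp r - 1) / r * norm f"
    using x r by (intro mult_right_mono divide_right_mono diff_right_mono) auto
  finally show "norm (fun01 (K_op \<zeta> f) x) \<le> (exp r - 1) / r * norm f" .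
qed

lemma K_op_bounded:
  obtains B where "0 \<le> B" "\<And>f. norm (K_op \<zeta> f) \<le> B * norm f"
proof
  \<comment> \<open>Adding 1 keeps the exponent positive even at \<open>\<zeta> = 0\<close>.\<close>
  let ?r = "norm \<zeta> + 1"
  have "Re \<zeta> \<le> ?r" using complex_Re_le_cmod[of \<zeta>] by linarith
  then show "norm (K_op \<zeta> f) \<le> (exp ?r - 1) / ?r * norm f" for f
    by (intro norm_K_op_le) (auto intro: add_nonneg_pos)
  show "0 \<le> (exp ?r - 1) / ?r" by simp
qed

text \<open>By linearity, the norm bound is a Lipschitz estimate.\<close>

lemma continuous_on_resolvent: "continuous_on E_space (resolvent F_space T_op \<zeta>)"
proof -
  obtain B where B: "0 \<le> B" "\<And>f. norm (K_op \<zeta> f) \<le> B * norm f"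
    using K_op_bounded by blast
  have "B-lipschitz_on UNIV (K_op \<zeta>)"
    by (rule lipschitz_onI) (auto simp: dist_norm B simp flip: K_op_diff)
  then have "continuous_on E_space (\<lambda>f. - K_op \<zeta> f)"
    by (intro continuous_on_minus)
       (rule continuous_on_subset[OF lipschitz_on_continuous_on], auto)
  then show ?thesis by (rule continuous_on_eq) (simp add: resolvent_eq)
qed

text \<open>The resolvent identity \<open>T R f = \<zeta> R f - f\<close> bounds the derivative part
  of the graph norm by the sup norms of \<open>R f\<close> and \<open>f\<close>.\<close>

lemma bounded_clinear_on_resolvent:
  "bounded_clinear_on E_space (graph_norm T_op) (resolvent F_space T_op \<zeta>)"
proof -
  obtain B where B: "0 \<le> B" "\<And>f. norm (K_op \<zeta> f) \<le> B * norm f"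
    using K_op_bounded by blast
  have "graph_norm T_op (- K_op \<zeta> f) \<le> (B + norm \<zeta> * B + 1) * norm f" if "f \<in> E_space" for f
  proof -
    have "T_op (- K_op \<zeta> f) = \<zeta> *\<^sub>C (- K_op \<zeta> f) - f"
      using minus_K_op_in_F_space(2)[OF that, of \<zeta>] by (simp add: algebra_simps)
    then have "norm (T_op (- K_op \<zeta> f)) \<le> norm \<zeta> * norm (K_op \<zeta> f) + norm f"
      using norm_triangle_ineq4[of "\<zeta> *\<^sub>C (- K_op \<zeta> f)" f] by (simp add: norm_scaleC)
    also have "\<dots> \<le> norm \<zeta> * (B * norm f) + norm f"
      by (intro add_right_mono mult_left_mono B) auto
    finally show ?thesis
      using B(2)[of f] by (simp add: graph_norm_def algebra_simps)
  qed
  moreover have "clinear_on E_space (resolvent F_space T_op \<zeta>)"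
  proof -
    have "resolvent F_space T_op \<zeta> (c *\<^sub>C f) = c *\<^sub>C resolvent F_space T_op \<zeta> f"
      if "f \<in> E_space" for c f
      using that csubspace_E_space
      by (auto simp: resolvent_eq csubspace_def K_op_scaleC intro!: fun01_eqI)
    moreover have "resolvent F_space T_op \<zeta> (f + g)
        = resolvent F_space T_op \<zeta> f + resolvent F_space T_op \<zeta> g"
      if "f \<in> E_space" "g \<in> E_space" for f g
      using that csubspace_E_space by (auto simp: resolvent_eq csubspace_def K_op_add)
    ultimately show ?thesis by (simp add: clinear_on_def)
  qed
  ultimately show ?thesis
    unfolding bounded_clinear_on_def by (auto simp: resolvent_eq)
qed

section \<open>Lower bound for the norm and its growth\<close>

text \<open>Rather than computing the integral, check that \<open>w\<close> solves
  \<open>w' = \<zeta> w + x\<close> with \<open>w 0 = 0\<close> and apply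
  \<open>K_op_eqI\<close>.\<close>

lemma K_op_identity_at_1:
  fixes \<zeta> :: real
  assumes "\<zeta> \<noteq> 0"
  shows "fun01 (K_op (complex_of_real \<zeta>) (mk01 complex_of_real)) 1
    = complex_of_real ((exp \<zeta> - 1 - \<zeta>) / \<zeta>\<^sup>2)"
proof -
  define w where "w x = complex_of_real ((exp (\<zeta> * x) - 1 - \<zeta> * x) / \<zeta>\<^sup>2)" for x
  define u where "u = mk01 w"
  define f where "f = mk01 complex_of_real"
  have f: "fun01 f x = complex_of_real x" if "x \<in> {0..1}" for x
    using that unfolding f_def by (intro fun01_mk01 continuous_intros)
  have u: "fun01 u x = w x" if "x \<in> {0..1}" for x
    using that assms unfolding u_def w_def by (intro fun01_mk01 continuous_intros) auto
  have deriv: "(fun01 u has_vector_derivative fun01 (\<zeta> *\<^sub>C u + f) x) (at x within {0..1})"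
    if x: "x \<in> {0..1}" for x
  proof (rule has_vector_derivative_transform[OF x u])
    have "((\<lambda>x. (exp (\<zeta> * x) - 1 - \<zeta> * x) / \<zeta>\<^sup>2) has_real_derivative (exp (\<zeta> * x) - 1) / \<zeta>)
        (at x within {0..1})"
      using assms by (auto intro!: derivative_eq_intros simp: field_simps power2_eq_square)
    then have "(w has_vector_derivative complex_of_real ((exp (\<zeta> * x) - 1) / \<zeta>))
        (at x within {0..1})"
      unfolding w_def[abs_def]
      by (intro has_vector_derivative_of_real)
         (simp flip: has_real_derivative_iff_has_vector_derivative)
    moreover have "complex_of_real ((exp (\<zeta> * x) - 1) / \<zeta>) = fun01 (\<zeta> *\<^sub>C u + f) x"
    proof -
      have "(exp (\<zeta> * x) - 1) / \<zeta> = \<zeta> * ((exp (\<zeta> * x) - 1 - \<zeta> * x) / \<zeta>\<^sup>2) + x"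
        using assms by (simp add: field_simps power2_eq_square)
      then show ?thesis
        using x by (simp only: fun01_add fun01_scaleC u f w_def of_real_add of_real_mult)
    qed
    ultimately show "(w has_vector_derivative fun01 (\<zeta> *\<^sub>C u + f) x) (at x within {0..1})"
      by simp
  qed
  have "fun01 u 0 = 0" using u[of 0] by (simp add: w_def)
  moreover have "u \<in> D_space" by (rule D_spaceI(1)[OF deriv])
  moreover have "T_op u = \<zeta> *\<^sub>C u + f" by (rule D_spaceI(2)[OF deriv])
  ultimately have "K_op \<zeta> f = u"
    using K_op_eqI[of u \<zeta>] by simp
  then show ?thesis
    using u[of 1] by (simp add: f_def w_def)
qed

lemma onorm_resolvent_bounds:
  fixes \<zeta> :: real
  assumes "0 < \<zeta>"
  shows "(exp \<zeta> - 1 - \<zeta>) / \<zeta>\<^sup>2 \<le> onorm_on E_space (resolvent F_space T_op \<zeta>)"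
    and "onorm_on E_space (resolvent F_space T_op \<zeta>) \<le> (exp \<zeta> - 1) / \<zeta>"
proof -
  let ?q = "\<lambda>f. norm (resolvent F_space T_op \<zeta> f) / norm f"
  have q: "?q f \<le> (exp \<zeta> - 1) / \<zeta>" if "f \<in> E_space" for f
  proof (cases "f = 0")
    case True
    \<comment> \<open>Division by zero makes the quotient 0, and the bound is nonnegative.\<close>
    then show ?thesis using assms by simp
  next
    case False
    then show ?thesis
      using that assms norm_K_op_le[of \<zeta> "complex_of_real \<zeta>" f]
      by (simp add: resolvent_eq pos_divide_le_eq)
  qed
  have "E_space \<noteq> {}"
    using csubspace_E_space by (auto simp: csubspace_def)
  then show "onorm_on E_space (resolvent F_space T_op \<zeta>) \<le> (exp \<zeta> - 1) / \<zeta>"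
    unfolding onorm_on_def by (rule cSUP_least) (rule q)
  \<comment> \<open>The constant 1 would attain the upper bound at the endpoint 1 but does not
    vanish at 0; the identity function lies in \<open>E_space\<close> and also has norm 1.\<close>
  define f where "f = mk01 complex_of_real"
  have f: "fun01 f x = complex_of_real x" if "x \<in> {0..1}" for x
    using that unfolding f_def by (intro fun01_mk01 continuous_intros)
  have fE: "f \<in> E_space" by (simp add: E_space_def Lambda_def f)
  have "norm f \<le> 1" by (rule norm_C01_le) (simp add: f)
  moreover have "1 \<le> norm f" using norm_fun01_le[of f 1] by (simp add: f)
  ultimately have norm_f: "norm f = 1" by simp
  have "(exp \<zeta> - 1 - \<zeta>) / \<zeta>\<^sup>2 \<le> norm (fun01 (K_op \<zeta> f) 1)"
    using assms by (simp only: f_def K_op_identity_at_1 norm_of_real abs_ge_self)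
  also have "\<dots> \<le> ?q f"
    using norm_fun01_le[of "K_op \<zeta> f" 1] fE by (simp add: resolvent_eq norm_f)
  also have "\<dots> \<le> onorm_on E_space (resolvent F_space T_op \<zeta>)"
    unfolding onorm_on_def
    \<comment> \<open>The pointwise upper bound \<open>q\<close> supplies the boundedness that makes
      the supremum dominate each quotient.\<close>
    by (rule cSUP_upper[OF fE]) (use q in \<open>auto intro!: bdd_aboveI2\<close>)
  finally show "(exp \<zeta> - 1 - \<zeta>) / \<zeta>\<^sup>2 \<le> onorm_on E_space (resolvent F_space T_op \<zeta>)" .
qed

theorem mainTheorem2:
  shows "(closed E_space \<and>
          F_space = {u \<in> D_space. fun01 u 0 = 0 \<and> deriv01 u 0 = 0}) \<and>
    (\<forall>\<zeta>. bij_betw (\<lambda>u. \<zeta> *\<^sub>C u - T_op u) F_space E_space \<and>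
         continuous_on E_space (resolvent F_space T_op \<zeta>) \<and>
         bounded_clinear_on E_space (graph_norm T_op) (resolvent F_space T_op \<zeta>) \<and>
         (\<forall>f\<in>E_space. resolvent F_space T_op \<zeta> f = - K_op \<zeta> f)) \<and>
    (resolvent_set E_space F_space T_op = UNIV \<and> spectrum E_space F_space T_op = {}) \<and>
    (\<forall>\<zeta>::real. \<zeta> > 0 \<longrightarrow>
         (exp \<zeta> - 1 - \<zeta>) / \<zeta>\<^sup>2
           \<le> onorm_on E_space (resolvent F_space T_op (complex_of_real \<zeta>)) \<and>
         onorm_on E_space (resolvent F_space T_op (complex_of_real \<zeta>)) \<le> (exp \<zeta> - 1) / \<zeta>) \<and>
    filterlim (\<lambda>\<zeta>::real. onorm_on E_space (resolvent F_space T_op (complex_of_real \<zeta>)))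
      at_top at_top"
proof (intro conjI allI impI ballI)
  show "closed E_space" by (rule closed_E_space)
  show "F_space = {u \<in> D_space. fun01 u 0 = 0 \<and> deriv01 u 0 = 0}"
    by (auto simp: F_space_def E_space_def Lambda_def fun01_T_op)
  show "resolvent_set E_space F_space T_op = UNIV"
    by (auto simp: resolvent_set_def bij_betw_resolvent bounded_clinear_on_resolvent)
  then show "spectrum E_space F_space T_op = {}"
    by (simp add: spectrum_def)
  \<comment> \<open>The lower bound is available for positive \<open>\<zeta>\<close> only, hence
    eventually; its exponential outgrows the square in the denominator.\<close>
  have "eventually (\<lambda>\<zeta>::real. (exp \<zeta> - 1 - \<zeta>) / \<zeta>\<^sup>2
      \<le> onorm_on E_space (resolvent F_space T_op (complex_of_real \<zeta>))) at_top"
    using eventually_gt_at_top[of 0] by eventually_elim (rule onorm_resolvent_bounds(1))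
  moreover have "filterlim (\<lambda>\<zeta>::real. (exp \<zeta> - 1 - \<zeta>) / \<zeta>\<^sup>2) at_top at_top"
    by real_asymp
  ultimately show "filterlim (\<lambda>\<zeta>::real. onorm_on E_space
      (resolvent F_space T_op (complex_of_real \<zeta>))) at_top at_top"
    by (rule filterlim_at_top_mono[rotated])
qed (rule bij_betw_resolvent continuous_on_resolvent bounded_clinear_on_resolvent
    resolvent_eq onorm_resolvent_bounds | assumption)+

end
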